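(* Let $\mathbb{P}$ be a $0/1$ integer linear program $\min\{f(x)\mid x\in\{0,1\}^n,\ g_\ell(x)\ge 0 \text{ for } \ell\in[m]\}$ with $m\ge1$, $f$ and all $g_\ell$ affine-linear, such that no constraint $g_\ell(x)\ge0$ is satisfied by all points of $\{0,1\}^n$, and let $f(x_{I^*})$ denote the optimal value of $\mathbb{P}$ (the minimum of $f$ over feasible integral points). Then the Lasserre relaxation $\mathrm{Las}_{n-1}(\mathbb{P})$ has an integrality gap if and only if there exist real numbers $\{y_I^N\mid I\subseteq N\}$ such that (a) $y_I^N>0$ for all $I\subseteq N$; (b) $\sum_{I\subseteq N}y_I^N=1$; (c) for each $\ell\in[m]$ there is exactly one $K_\ell\subseteq N$ with $g_\ell(x_{K_\ell})y_{K_\ell}^N<0$; (d) for all $\ell\in[m]$ and all $J\subseteq N$ with $J\neq K_\ell$, $g_\ell(x_J)y_J^N>0$; (e) for all $\ell\in[m]$, $\sum_{I\subseteq N}\frac{1}{g_\ell(x_I)y_I^N}\le 0$; (f) $\sum_{I\subseteq N}y_I^N f(x_I)<f(x_{I^*})$.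
   Context: $N=\{1,\dots,n\}$, $[m]=\{1,\dots,m\}$. For $I\subseteq N$, $x_I\in\{0,1\}^n$ is the point with $x_i=1$ iff $i\in I$. $\mathcal{P}_t(N)$ is the collection of subsets of $N$ of size at most $t$. For $y\in\mathbb{R}^{\mathcal{P}_{s}(N)}$ the $t$-moment matrix $M_t(y)$ is indexed by $\mathcal{P}_t(N)$ with $(I,J)$-entry $y_{I\cup J}$. For an affine function $g(x)=\sum_i g_ix_i+g_0$, the shifted vector $g*y$ has entries $(g*y)_I=\sum_i g_iy_{I\cup\{i\}}+g_0y_I$. Writing $f$ as a multilinear polynomial $\sum_I f_I\prod_{i\in I}x_i$, the Lasserre relaxation at level $t$ (for problems with at least one linear constraint) is $\mathrm{Las}_t(\mathbb{P})=\min\{\sum_I f_Iy_I \mid y\in\mathbb{R}^{\mathcal{P}_{2t+2}(N)},\ y_\varnothing=1,\ M_{t+1}(y)\succeq0,\ M_t(g_\ell*y)\succeq 0\ \forall \ell\in[m]\}$. At level $t=n-1$, $y$ is indexed by all subsets of $N$, and one sets $y_I^N=\sum_{H\subseteq N\setminus I}(-1)^{|H|}y_{H\cup I}$; then $\sum_I f_Iy_I=\sum_{I\subseteq N}f(x_I)y_I^N$. The relaxation is said to have an integrality gap if its optimal value is strictly smaller than the optimal integral value $f(x_{I^*})$. *)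

theory Defs
  imports "HOL-Analysis.Analysis"
begin

(* The ground set N is UNIV :: 'n set, so n = CARD('n). *)

definition cube :: "(real ^ 'n) set" where
  "cube = {x. \<forall>i. x $ i \<in> {0, 1}}"

definition pt :: "'n set \<Rightarrow> real ^ 'n" where
  "pt I = (\<chi> i. if i \<in> I then 1 else 0)"

definition subsets_upto :: "nat \<Rightarrow> 'n::finite set set" where
  "subsets_upto t = {I. card I \<le> t}"

(* (c, c0) stands for the affine function x |-> (SUM i. c_i x_i) + c0; the coefficients are
   kept as data because the relaxation is defined from them. *)
type_synonym 'n affine = "(real ^ 'n) \<times> real"

definition aff :: "'n::finite affine \<Rightarrow> real ^ 'n \<Rightarrow> real" where
  "aff g x = fst g \<bullet> x + snd g"

definition ml_coeff :: "'n::finite affine \<Rightarrow> 'n set \<Rightarrow> real" where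
  "ml_coeff f I =
    (if I = {} then snd f else if card I = 1 then fst f $ (the_elem I) else 0)"

lemma aff_eq_multilinear:
  "aff f x = (\<Sum>I\<in>UNIV. ml_coeff f I * (\<Prod>i\<in>I. x $ i))"
proof -
  let ?h = "\<lambda>I. ml_coeff f I * (\<Prod>i\<in>I. x $ i)"
  have "(\<Sum>I\<in>UNIV. ?h I) = (\<Sum>I\<in>insert {} (range (\<lambda>i. {i})). ?h I)"
    by (rule sum.mono_neutral_right) (auto simp: ml_coeff_def card_1_singleton_iff)
  also have "\<dots> = ?h {} + (\<Sum>I\<in>range (\<lambda>i. {i}). ?h I)"
    by (rule sum.insert) auto
  also have "(\<Sum>I\<in>range (\<lambda>i. {i}). ?h I) = (\<Sum>i\<in>UNIV. ?h {i})"
    by (subst sum.reindex) (auto simp: inj_on_def)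
  finally show ?thesis
    by (simp add: aff_def ml_coeff_def inner_vec_def)
qed

definition ilp_feasible :: "nat \<Rightarrow> (nat \<Rightarrow> 'n::finite affine) \<Rightarrow> (real ^ 'n) set" where
  "ilp_feasible m g = {x \<in> cube. \<forall>l\<in>{1..m}. aff (g l) x \<ge> 0}"

(* Positive semidefiniteness of a real matrix whose rows and columns are indexed by
   the finite set A. *)
definition psd_on :: "'a set \<Rightarrow> ('a \<Rightarrow> 'a \<Rightarrow> real) \<Rightarrow> bool" where
  "psd_on A M \<longleftrightarrow>
    (\<forall>i\<in>A. \<forall>j\<in>A. M i j = M j i) \<and>
    (\<forall>v. (\<Sum>i\<in>A. \<Sum>j\<in>A. v i * M i j * v j) \<ge> 0)"

definition moment_matrix :: "('n set \<Rightarrow> real) \<Rightarrow> 'n set \<Rightarrow> 'n set \<Rightarrow> real" where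
  "moment_matrix y I J = y (I \<union> J)"

definition shift :: "'n::finite affine \<Rightarrow> ('n set \<Rightarrow> real) \<Rightarrow> 'n set \<Rightarrow> real" where
  "shift g y I = (\<Sum>i\<in>UNIV. fst g $ i * y (I \<union> {i})) + snd g * y I"

(* A vector indexed by subsets_upto (2 * t + 2) is represented by a total function; entries
   at larger sets occur neither in the constraints nor in the objective. *)
definition lasserre_feasible ::
  "nat \<Rightarrow> nat \<Rightarrow> (nat \<Rightarrow> 'n::finite affine) \<Rightarrow> ('n set \<Rightarrow> real) set" where
  "lasserre_feasible t m g =
    {y. y {} = 1 \<and>
        psd_on (subsets_upto (t + 1)) (moment_matrix y) \<and>
        (\<forall>l\<in>{1..m}. psd_on (subsets_upto t) (moment_matrix (shift (g l) y)))}"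

definition lasserre_objective ::
  "nat \<Rightarrow> 'n::finite affine \<Rightarrow> ('n set \<Rightarrow> real) \<Rightarrow> real" where
  "lasserre_objective t f y = (\<Sum>I\<in>subsets_upto (2 * t + 2). ml_coeff f I * y I)"

(* The optimal value as an infimum in the extended reals; it equals the minimum whenever
   that is attained. *)
definition lasserre_value ::
  "nat \<Rightarrow> 'n::finite affine \<Rightarrow> nat \<Rightarrow> (nat \<Rightarrow> 'n affine) \<Rightarrow> ereal" where
  "lasserre_value t f m g =
    (INF y\<in>lasserre_feasible t m g. ereal (lasserre_objective t f y))"

definition integrality_gap ::
  "nat \<Rightarrow> 'n::finite affine \<Rightarrow> nat \<Rightarrow> (nat \<Rightarrow> 'n affine) \<Rightarrow> real \<Rightarrow> bool" where
  "integrality_gap t f m g opt \<longleftrightarrow> lasserre_value t f m g < ereal opt"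

end

theory Submission
  imports Defs
begin

text \<open>In the coordinates \<open>z\<^sub>I = y\<^sub>I\<^sup>N\<close>, the full moment matrix becomes the diagonal form with
  entries \<open>z\<^sub>I\<close>, and the matrix of a constraint \<open>g\<close>, which only misses the index \<open>N\<close>, becomes the
  diagonal form with entries \<open>g (x\<^sub>I) z\<^sub>I\<close> restricted to the hyperplane of vectors with sum \<open>0\<close>.
  Such a restricted form is nonnegative if and only if either all entries are nonnegative or exactly
  one is negative, the others are positive and the sum of the reciprocals is at most \<open>0\<close>.
  A gap forces some \<open>z\<^sub>I > 0\<close> at an infeasible point, so the second case occurs for a constraint
  violated there; hence all \<open>z\<^sub>I\<close> are positive, and then the second case occurs for every constraint,
  since each one is violated somewhere on the cube.\<close>

section \<open>Diagonal forms on the hyperplane of zero-sum vectors\<close>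

text \<open>Testing with e_k - e_i gives \<open>a k + a i\<close> >= 0, so a negative entry
  \<open>a k\<close> forces all others to be positive. Then \<open>w k\<close> is minus the sum of
  the other coordinates, and Cauchy-Schwarz bounds its square; the reciprocal condition says that
  the sharp bound suffices.\<close>

lemma diagonal_form_nonneg_zero_sum_iff:
  fixes a :: "'a::finite \<Rightarrow> real"
  shows "(\<forall>w. sum w UNIV = 0 \<longrightarrow> (\<Sum>i\<in>UNIV. a i * (w i)\<^sup>2) \<ge> 0) \<longleftrightarrow>
    (\<forall>i. a i \<ge> 0) \<or> (\<exists>k. a k < 0 \<and> (\<forall>i. i \<noteq> k \<longrightarrow> a i > 0) \<and> (\<Sum>i\<in>UNIV. 1 / a i) \<le> 0)"
    (is "?psd \<longleftrightarrow> ?nonneg \<or> ?neg")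
proof
  assume psd: ?psd
  show "?nonneg \<or> ?neg"
  proof (rule disjCI)
    assume "\<not> ?neg"
    show ?nonneg
    proof (rule ccontr)
      assume "\<not> ?nonneg"
      then obtain k where k: "a k < 0" by (auto simp: not_le)
      have pos: "a i > 0" if "i \<noteq> k" for i
      proof -
        define w where "w j = (if j = k then 1 else if j = i then -1 else (0::real))" for j
        have split: "(\<Sum>j\<in>UNIV. h j) = h k + h i" if "\<And>j. j \<noteq> k \<Longrightarrow> j \<noteq> i \<Longrightarrow> h j = 0"
          for h :: "'a \<Rightarrow> real"
        proof -
          have "(\<Sum>j\<in>UNIV. h j) = sum h {k, i}"
            by (rule sum.mono_neutral_right) (use that in auto)
          then show ?thesis using \<open>i \<noteq> k\<close> by auto
        qed
        have "sum w UNIV = 0"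
          using \<open>i \<noteq> k\<close> by (subst split) (auto simp: w_def)
        with psd have "(\<Sum>j\<in>UNIV. a j * (w j)\<^sup>2) \<ge> 0" by blast
        also have "(\<Sum>j\<in>UNIV. a j * (w j)\<^sup>2) = a k + a i"
          using \<open>i \<noteq> k\<close> by (subst split) (auto simp: w_def)
        finally show ?thesis using k by simp
      qed
      define S where "S = (\<Sum>i\<in>UNIV - {k}. 1 / a i)"
      \<comment> \<open>Off \<open>k\<close> this is the equality case of Cauchy-Schwarz with
        weights \<open>a i\<close>; the form takes the value \<open>S * (a k * S + 1)\<close> on
        it.\<close>
      define w where "w i = (if i = k then - S else 1 / a i)" for i
      have "sum w UNIV = w k + sum w (UNIV - {k})"
        by (rule sum.remove) auto
      also have "sum w (UNIV - {k}) = S"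
        unfolding S_def by (rule sum.cong) (auto simp: w_def)
      finally have "sum w UNIV = 0" by (simp add: w_def)
      with psd have "(\<Sum>i\<in>UNIV. a i * (w i)\<^sup>2) \<ge> 0" by blast
      also have "(\<Sum>i\<in>UNIV. a i * (w i)\<^sup>2) = a k * (w k)\<^sup>2 + (\<Sum>i\<in>UNIV - {k}. a i * (w i)\<^sup>2)"
        by (rule sum.remove) auto
      also have "(\<Sum>i\<in>UNIV - {k}. a i * (w i)\<^sup>2) = S"
        unfolding S_def
      proof (rule sum.cong)
        fix i assume "i \<in> UNIV - {k}"
        with pos[of i] show "a i * (w i)\<^sup>2 = 1 / a i"
          by (auto simp: w_def power2_eq_square)
      qed simp
      finally have nonneg: "S * (a k * S + 1) \<ge> 0"
        by (simp add: w_def power2_eq_square algebra_simps)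
      have "S \<ge> 0"
        unfolding S_def using pos by (intro sum_nonneg) (auto intro: less_imp_le)
      \<comment> \<open>If \<open>S = 0\<close>, then \<open>k\<close> is the only index and the
        sign of \<open>a k\<close> decides; otherwise the positive factor \<open>S\<close>
        cancels.\<close>
      have "1 / a k + S \<le> 0"
      proof (cases "S = 0")
        case True
        with k show ?thesis by (simp add: field_simps)
      next
        case False
        with \<open>S \<ge> 0\<close> nonneg have "a k * S + 1 \<ge> 0"
          by (simp add: zero_le_mult_iff)
        with k show ?thesis by (simp add: field_simps)
      qed
      also have "1 / a k + S = (\<Sum>i\<in>UNIV. 1 / a i)"
        unfolding S_def by (rule sum.remove[symmetric]) auto
      finally show False using \<open>\<not> ?neg\<close> k pos by blast
    qed
  qed
next
  assume "?nonneg \<or> ?neg"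
  then show ?psd
  proof
    assume ?nonneg
    then show ?psd by (auto intro!: sum_nonneg)
  next
    assume ?neg
    then obtain k where k: "a k < 0" and pos: "\<And>i. i \<noteq> k \<Longrightarrow> a i > 0"
      and recip: "(\<Sum>i\<in>UNIV. 1 / a i) \<le> 0" by blast
    define S where "S = (\<Sum>i\<in>UNIV - {k}. 1 / a i)"
    have "(\<Sum>i\<in>UNIV. 1 / a i) = 1 / a k + S"
      unfolding S_def by (rule sum.remove) auto
    with recip k have S: "a k * S + 1 \<ge> 0" by (simp add: field_simps)
    show ?psd
    proof (intro allI impI)
      fix w :: "'a \<Rightarrow> real"
      assume "sum w UNIV = 0"
      moreover have "sum w UNIV = w k + sum w (UNIV - {k})"
        by (rule sum.remove) auto
      ultimately have wk: "w k = - sum w (UNIV - {k})" by simp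
      define Q where "Q = (\<Sum>i\<in>UNIV - {k}. a i * (w i)\<^sup>2)"
      have "Q \<ge> 0"
        unfolding Q_def using pos by (intro sum_nonneg mult_nonneg_nonneg) (auto intro: less_imp_le)
      \<comment> \<open>Splitting each \<open>w i\<close> with weight \<open>sqrt (a i)\<close>
        yields \<open>S * Q\<close> as a bound for the square of \<open>w k\<close>. As
        \<open>a k\<close> is negative, the form is then at least
        \<open>(a k * S + 1) * Q\<close>.\<close>
      have "(w k)\<^sup>2 = (\<Sum>i\<in>UNIV - {k}. sqrt (1 / a i) * (sqrt (a i) * w i))\<^sup>2"
        unfolding wk power2_minus
        by (intro arg_cong[where f = "\<lambda>x. x\<^sup>2"] sum.cong)
          (use pos in \<open>auto simp: real_sqrt_divide less_imp_neq[THEN not_sym]\<close>)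
      also have "\<dots> \<le> (\<Sum>i\<in>UNIV - {k}. (sqrt (1 / a i))\<^sup>2) * (\<Sum>i\<in>UNIV - {k}. (sqrt (a i) * w i)\<^sup>2)"
        by (rule Cauchy_Schwarz_ineq_sum)
      also have "(\<Sum>i\<in>UNIV - {k}. (sqrt (1 / a i))\<^sup>2) = S"
        unfolding S_def using pos by (intro sum.cong) (auto simp: less_imp_le)
      also have "(\<Sum>i\<in>UNIV - {k}. (sqrt (a i) * w i)\<^sup>2) = Q"
        unfolding Q_def using pos
        by (intro sum.cong) (auto simp: power_mult_distrib less_imp_le)
      finally have "a k * (S * Q) \<le> a k * (w k)\<^sup>2"
        using k by (intro mult_left_mono_neg) auto
      moreover have "(a k * S + 1) * Q \<ge> 0"
        using S \<open>Q \<ge> 0\<close> by simp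
      moreover have "(\<Sum>i\<in>UNIV. a i * (w i)\<^sup>2) = a k * (w k)\<^sup>2 + Q"
        unfolding Q_def by (rule sum.remove) auto
      ultimately show "(\<Sum>i\<in>UNIV. a i * (w i)\<^sup>2) \<ge> 0"
        by (simp add: algebra_simps)
    qed
  qed
qed

section \<open>Diagonalisation of moment matrices\<close>

text \<open>The moments of the signed measure with mass \<open>z J\<close> at \<open>pt J\<close>;
  this inverts the alternating sum that takes y to y^N.\<close>

definition superset_sum :: "('n::finite set \<Rightarrow> real) \<Rightarrow> 'n set \<Rightarrow> real" where
  "superset_sum z I = (\<Sum>J | I \<subseteq> J. z J)"

lemma superset_sum_eq_if: "superset_sum z I = (\<Sum>J\<in>UNIV. if I \<subseteq> J then z J else 0)"
  by (simp add: superset_sum_def sum.If_cases)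

text \<open>Moebius inversion on subsets in its symmetric form: the signed subset sum is an
  involution. It produces the vectors with prescribed sums over \<open>Pow H\<close> needed
  below.\<close>

lemma sum_Pow_moebius:
  fixes h :: "'n::finite set \<Rightarrow> real"
  shows "(\<Sum>I\<in>Pow S. (-1) ^ card I * (\<Sum>R\<in>Pow I. (-1) ^ card R * h R)) = h S"
  by (rule inclusion_exclusion_symmetric[symmetric]) auto

text \<open>Complementation turns supersets into subsets, where the involution solves for the
  masses.\<close>

lemma superset_sum_surj: "\<exists>z. y = superset_sum z"
proof -
  define z' where
    "z' B = (-1) ^ card B * (\<Sum>R\<in>Pow B. (-1) ^ card R * y (- R))" for B :: "'a set"
  have "y I = superset_sum (\<lambda>J. z' (- J)) I" for I
  proof -
    have "superset_sum (\<lambda>J. z' (- J)) I = sum z' (Pow (- I))"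
      unfolding superset_sum_def by (rule sum.reindex_bij_witness[of _ uminus uminus]) auto
    also have "\<dots> = y I"
      unfolding z'_def using sum_Pow_moebius[of "\<lambda>R. y (- R)" "- I"] by simp
    finally show ?thesis by simp
  qed
  then show ?thesis by blast
qed

lemma ex_superset_sum: "(\<exists>y. P y) \<longleftrightarrow> (\<exists>z. P (superset_sum z))"
proof
  assume "\<exists>y. P y"
  then obtain y where "P y" ..
  moreover obtain z where "y = superset_sum z" using superset_sum_surj by blast
  ultimately show "\<exists>z. P (superset_sum z)" by blast
qed blast

text \<open>\<open>I \<union> J \<subseteq> H\<close> holds iff both sets lie in \<open>H\<close>,
  so the matrix is a sum over \<open>H\<close> of rank-one matrices weighted by
  \<open>z H\<close>.\<close>

lemma moment_form_superset_sum:
  fixes z :: "'n::finite set \<Rightarrow> real"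
  shows "(\<Sum>I\<in>A. \<Sum>J\<in>A. v I * moment_matrix (superset_sum z) I J * v J) =
    (\<Sum>H\<in>UNIV. z H * (\<Sum>I\<in>A \<inter> Pow H. v I)\<^sup>2)"
proof -
  have "(\<Sum>I\<in>A. \<Sum>J\<in>A. v I * moment_matrix (superset_sum z) I J * v J) =
    (\<Sum>I\<in>A. \<Sum>J\<in>A. \<Sum>H\<in>UNIV. z H * ((if I \<subseteq> H then v I else 0) * (if J \<subseteq> H then v J else 0)))"
    unfolding moment_matrix_def superset_sum_eq_if sum_distrib_left sum_distrib_right
    by (intro sum.cong) auto
  also have "\<dots> = (\<Sum>I\<in>A. \<Sum>H\<in>UNIV. \<Sum>J\<in>A.
      z H * ((if I \<subseteq> H then v I else 0) * (if J \<subseteq> H then v J else 0)))"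
    by (intro sum.cong sum.swap) auto
  also have "\<dots> = (\<Sum>H\<in>UNIV. \<Sum>I\<in>A. \<Sum>J\<in>A.
      z H * ((if I \<subseteq> H then v I else 0) * (if J \<subseteq> H then v J else 0)))"
    by (rule sum.swap)
  also have "\<dots> = (\<Sum>H\<in>UNIV. z H * (\<Sum>I\<in>A. if I \<subseteq> H then v I else 0)\<^sup>2)"
    by (simp only: power2_eq_square sum_product) (simp only: sum_distrib_left)
  also have "\<dots> = (\<Sum>H\<in>UNIV. z H * (\<Sum>I\<in>A \<inter> Pow H. v I)\<^sup>2)"
    by (simp add: sum.If_cases Pow_def)
  finally show ?thesis .
qed

lemma psd_on_superset_sum_iff:
  "psd_on A (moment_matrix (superset_sum z)) \<longleftrightarrow>
    (\<forall>v. (\<Sum>H\<in>UNIV. z H * (\<Sum>I\<in>A \<inter> Pow H. v I)\<^sup>2) \<ge> 0)"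
  unfolding psd_on_def moment_form_superset_sum
  by (simp add: moment_matrix_def Un_commute)

lemma psd_on_UNIV_superset_sum_iff:
  fixes z :: "'n::finite set \<Rightarrow> real"
  shows "psd_on UNIV (moment_matrix (superset_sum z)) \<longleftrightarrow> (\<forall>I. z I \<ge> 0)"
proof
  assume psd: "psd_on UNIV (moment_matrix (superset_sum z))"
  show "\<forall>I. z I \<ge> 0"
  proof
    fix K :: "'n set"
    \<comment> \<open>The sum of \<open>v\<close> over \<open>Pow H\<close> is 1 for
      \<open>H = K\<close> and 0 otherwise, which isolates \<open>z K\<close>.\<close>
    define v where
      "v I = (-1) ^ card I * (\<Sum>R\<in>Pow I. (-1) ^ card R * (if R = K then 1 else 0 :: real))" for I
    have "0 \<le> (\<Sum>H\<in>UNIV. z H * (\<Sum>I\<in>UNIV \<inter> Pow H. v I)\<^sup>2)"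
      using psd unfolding psd_on_superset_sum_iff by blast
    also have "\<dots> = (\<Sum>H\<in>UNIV. if H = K then z H else 0)"
      unfolding v_def Int_UNIV_left sum_Pow_moebius by (intro sum.cong) auto
    finally show "z K \<ge> 0" by simp
  qed
next
  assume "\<forall>I. z I \<ge> 0"
  then show "psd_on UNIV (moment_matrix (superset_sum z))"
    unfolding psd_on_superset_sum_iff by (auto intro!: sum_nonneg)
qed

text \<open>Dropping the index \<open>UNIV\<close> amounts to \<open>v UNIV = 0\<close>. By
  inversion this says that the alternating sum over \<open>H\<close> of the subset sums of
  \<open>v\<close> vanishes. The twist by \<open>(-1) ^ card H\<close> makes it a plain zero-sum
  condition and leaves the squares unchanged.\<close>

lemma psd_on_proper_superset_sum_iff:
  fixes a :: "'n::finite set \<Rightarrow> real"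
  shows "psd_on (UNIV - {UNIV}) (moment_matrix (superset_sum a)) \<longleftrightarrow>
    (\<forall>w. sum w UNIV = 0 \<longrightarrow> (\<Sum>H\<in>UNIV. a H * (w H)\<^sup>2) \<ge> 0)"
  unfolding psd_on_superset_sum_iff
proof (intro iffI allI impI)
  fix w :: "'n set \<Rightarrow> real"
  assume psd: "\<forall>v. (\<Sum>H\<in>UNIV. a H * (\<Sum>I\<in>(UNIV - {UNIV}) \<inter> Pow H. v I)\<^sup>2) \<ge> 0"
    and sum0: "sum w UNIV = 0"
  \<comment> \<open>The two inner signs cancel, so \<open>v UNIV\<close> is the sum of
    \<open>w\<close> up to sign; they are kept so that the inversion applies to the twisted
    \<open>w\<close>.\<close>
  define v where "v I = (-1) ^ card I * (\<Sum>R\<in>Pow I. (-1) ^ card R * ((-1) ^ card R * w R))" for I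
  have "v UNIV = 0"
    using sum0 by (simp add: v_def flip: mult.assoc power_mult_distrib)
  have "(\<Sum>I\<in>(UNIV - {UNIV}) \<inter> Pow H. v I) = (-1) ^ card H * w H" for H
  proof -
    have "(\<Sum>I\<in>(UNIV - {UNIV}) \<inter> Pow H. v I) = sum v (Pow H)"
      by (rule sum.mono_neutral_left) (use \<open>v UNIV = 0\<close> in auto)
    then show ?thesis unfolding v_def sum_Pow_moebius .
  qed
  with psd[rule_format, of v] show "(\<Sum>H\<in>UNIV. a H * (w H)\<^sup>2) \<ge> 0"
    by (simp add: power_mult_distrib flip: power_mult)
next
  fix v :: "'n set \<Rightarrow> real"
  assume psd: "\<forall>w. sum w UNIV = 0 \<longrightarrow> (\<Sum>H\<in>UNIV. a H * (w H)\<^sup>2) \<ge> 0"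
  \<comment> \<open>Extending by 0 at \<open>UNIV\<close> lets the inversion, read at
    \<open>UNIV\<close>, give the sum of \<open>w\<close> as \<open>v' UNIV\<close>.\<close>
  define v' where "v' I = (if I = UNIV then 0 else (-1) ^ card I * v I)" for I
  define w where "w H = (-1) ^ card H * (\<Sum>I\<in>(UNIV - {UNIV}) \<inter> Pow H. v I)" for H
  have "w H = (-1) ^ card H * (\<Sum>I\<in>Pow H. (-1) ^ card I * v' I)" for H
  proof -
    have "(\<Sum>I\<in>Pow H. (-1) ^ card I * v' I) = (\<Sum>I\<in>(UNIV - {UNIV}) \<inter> Pow H. v I)"
      by (rule sum.mono_neutral_cong_right)
        (auto simp: v'_def simp flip: mult.assoc power_mult_distrib)
    then show ?thesis by (simp add: w_def)
  qed
  then have "sum w (Pow UNIV) = v' UNIV"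
    using sum_Pow_moebius[of v' UNIV] by simp
  then have "sum w UNIV = 0" by (simp add: v'_def)
  with psd have "(\<Sum>H\<in>UNIV. a H * (w H)\<^sup>2) \<ge> 0" by blast
  then show "(\<Sum>H\<in>UNIV. a H * (\<Sum>I\<in>(UNIV - {UNIV}) \<inter> Pow H. v I)\<^sup>2) \<ge> 0"
    by (simp add: w_def power_mult_distrib flip: power_mult)
qed

section \<open>The relaxation at level \<open>n - 1\<close>\<close>

lemma pt_nth: "pt I $ i = (if i \<in> I then 1 else 0)"
  by (simp add: pt_def)

lemma pt_in_cube: "pt I \<in> cube"
  by (simp add: cube_def pt_nth)

lemma cube_eq_range_pt: "cube = range pt"
proof
  show "cube \<subseteq> range pt"
  proof
    fix x :: "real ^ 'n"
    assume "x \<in> cube"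
    then have "x = pt {i. x $ i = 1}"
      by (auto simp: cube_def vec_eq_iff pt_nth)
    then show "x \<in> range pt" by blast
  qed
qed (auto intro: pt_in_cube)

text \<open>Shifting multiplies the measure by the density \<open>aff g\<close>: the coefficients
  with \<open>i \<in> J\<close> and the constant add up to its value at \<open>pt J\<close>.\<close>

lemma shift_superset_sum:
  "shift g (superset_sum z) = superset_sum (\<lambda>J. aff g (pt J) * z J)"
proof
  fix I
  have "shift g (superset_sum z) I =
    (\<Sum>J\<in>UNIV. \<Sum>i\<in>UNIV. fst g $ i * (if I \<union> {i} \<subseteq> J then z J else 0)) +
    (\<Sum>J\<in>UNIV. snd g * (if I \<subseteq> J then z J else 0))"
    unfolding shift_def superset_sum_eq_if sum_distrib_left by (subst sum.swap) simp
  also have "\<dots> = (\<Sum>J\<in>UNIV. if I \<subseteq> J then aff g (pt J) * z J else 0)"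
    unfolding sum.distrib[symmetric]
    by (intro sum.cong)
      (auto simp: aff_def inner_vec_def pt_nth sum_distrib_right distrib_right intro!: sum.cong)
  finally show "shift g (superset_sum z) I = superset_sum (\<lambda>J. aff g (pt J) * z J) I"
    by (simp add: superset_sum_eq_if
        del: One_nat_def)
qed

lemma sum_ml_coeff_superset_sum:
  "(\<Sum>I\<in>UNIV. ml_coeff f I * superset_sum z I) = (\<Sum>J\<in>UNIV. z J * aff f (pt J))"
proof -
  have monomial: "(\<Prod>i\<in>I. pt J $ i) = (if I \<subseteq> J then 1 else 0)" for I J :: "'a set"
    by (auto simp: pt_nth intro!: prod.neutral)
  have "(\<Sum>I\<in>UNIV. ml_coeff f I * superset_sum z I) =
    (\<Sum>J\<in>UNIV. \<Sum>I\<in>UNIV. ml_coeff f I * (if I \<subseteq> J then z J else 0))"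
    unfolding superset_sum_eq_if sum_distrib_left by (rule sum.swap)
  also have "\<dots> = (\<Sum>J\<in>UNIV. z J * aff f (pt J))"
    unfolding aff_eq_multilinear monomial sum_distrib_left by (intro sum.cong) auto
  finally show ?thesis .
qed

lemma subsets_upto_card_UNIV:
  assumes "t \<ge> CARD('n::finite)"
  shows "subsets_upto t = (UNIV :: 'n set set)"
proof -
  have "card I \<le> t" for I :: "'n set"
    using card_mono[of UNIV I] assms by simp
  then show ?thesis by (auto simp: subsets_upto_def)
qed

lemma subsets_upto_card_UNIV_minus_1:
  "subsets_upto (CARD('n::finite) - 1) = (UNIV - {UNIV :: 'n set})"
proof -
  have "card I \<le> CARD('n) - 1 \<longleftrightarrow> I \<noteq> UNIV" for I :: "'n set"
  proof
    assume "I \<noteq> UNIV"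
    then have "card I < CARD('n)" by (intro psubset_card_mono) auto
    then show "card I \<le> CARD('n) - 1" by simp
  next
    assume "card I \<le> CARD('n) - 1"
    \<comment> \<open>Positivity keeps the natural-number subtraction from being truncated.\<close>
    moreover have "CARD('n) > 0" by simp
    ultimately show "I \<noteq> UNIV" by (metis diff_less leD zero_less_one)
  qed
  then show ?thesis by (auto simp: subsets_upto_def)
qed

lemma lasserre_feasible_superset_sum_iff:
  fixes g :: "nat \<Rightarrow> 'n::finite affine"
  shows "superset_sum z \<in> lasserre_feasible (CARD('n) - 1) m g \<longleftrightarrow>
    sum z UNIV = 1 \<and> (\<forall>I. z I \<ge> 0) \<and>
    (\<forall>l\<in>{1..m}. (\<forall>I. aff (g l) (pt I) * z I \<ge> 0) \<or>
      (\<exists>K. aff (g l) (pt K) * z K < 0 \<and> (\<forall>J. J \<noteq> K \<longrightarrow> aff (g l) (pt J) * z J > 0) \<and>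
        (\<Sum>I\<in>UNIV. 1 / (aff (g l) (pt I) * z I)) \<le> 0))"
proof -
  have full: "subsets_upto (CARD('n) - 1 + 1) = (UNIV :: 'n set set)"
    by (rule subsets_upto_card_UNIV) simp
  have empty: "superset_sum z {} = sum z UNIV"
    by (simp add: superset_sum_def)
  show ?thesis
    unfolding lasserre_feasible_def mem_Collect_eq full empty psd_on_UNIV_superset_sum_iff
      shift_superset_sum subsets_upto_card_UNIV_minus_1 psd_on_proper_superset_sum_iff
      diagonal_form_nonneg_zero_sum_iff ..
qed

lemma lasserre_objective_superset_sum:
  "lasserre_objective (CARD('n) - 1) f (superset_sum z) = (\<Sum>I\<in>UNIV. z I * aff f (pt I))"
  for f :: "'n::finite affine"
proof -
  have "subsets_upto (2 * (CARD('n) - 1) + 2) = (UNIV :: 'n set set)"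
    by (rule subsets_upto_card_UNIV) simp
  then show ?thesis
    unfolding lasserre_objective_def by (simp add: sum_ml_coeff_superset_sum)
qed

text \<open>An infimum is strictly below a number iff some member is, and surjectivity lets the
  witness be given by its masses.\<close>

lemma integrality_gap_iff_superset_sum:
  fixes f :: "'n::finite affine"
  shows "integrality_gap (CARD('n) - 1) f m g opt \<longleftrightarrow>
    (\<exists>z. superset_sum z \<in> lasserre_feasible (CARD('n) - 1) m g \<and>
      (\<Sum>I\<in>UNIV. z I * aff f (pt I)) < opt)"
proof -
  have "integrality_gap (CARD('n) - 1) f m g opt \<longleftrightarrow>
    (\<exists>y\<in>lasserre_feasible (CARD('n) - 1) m g. lasserre_objective (CARD('n) - 1) f y < opt)"
    by (simp add: integrality_gap_def lasserre_value_def INF_less_iff)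
  also have "\<dots> \<longleftrightarrow> (\<exists>z. superset_sum z \<in> lasserre_feasible (CARD('n) - 1) m g \<and>
      lasserre_objective (CARD('n) - 1) f (superset_sum z) < opt)"
    unfolding Bex_def by (rule ex_superset_sum)
  finally show ?thesis by (simp only: lasserre_objective_superset_sum)
qed

theorem theorem1:
  fixes f :: "'n::finite affine"
    and g :: "nat \<Rightarrow> 'n affine"
    and m :: nat
    and Iopt :: "'n set"
  assumes "m \<ge> 1"
    and "\<forall>l\<in>{1..m}. \<not> (\<forall>x\<in>cube. aff (g l) x \<ge> 0)"
    and "is_arg_min (aff f) (\<lambda>x. x \<in> ilp_feasible m g) (pt Iopt)"
  shows "integrality_gap (CARD('n) - 1) f m g (aff f (pt Iopt)) \<longleftrightarrow>
    (\<exists>(yN :: 'n set \<Rightarrow> real) (K :: nat \<Rightarrow> 'n set).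
      (\<forall>I. yN I > 0) \<and>
      (\<Sum>I\<in>UNIV. yN I) = 1 \<and>
      (\<forall>l\<in>{1..m}. (\<exists>!I. aff (g l) (pt I) * yN I < 0) \<and>
                   aff (g l) (pt (K l)) * yN (K l) < 0) \<and>
      (\<forall>l\<in>{1..m}. \<forall>J. J \<noteq> K l \<longrightarrow> aff (g l) (pt J) * yN J > 0) \<and>
      (\<forall>l\<in>{1..m}. (\<Sum>I\<in>UNIV. 1 / (aff (g l) (pt I) * yN I)) \<le> 0) \<and>
      (\<Sum>I\<in>UNIV. yN I * aff f (pt I)) < aff f (pt Iopt))"
    (is "?gap \<longleftrightarrow> ?cert")
proof
  assume ?gap
  then obtain z where feas: "superset_sum z \<in> lasserre_feasible (CARD('n) - 1) m g"
    and less: "(\<Sum>I\<in>UNIV. z I * aff f (pt I)) < aff f (pt Iopt)"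
    unfolding integrality_gap_iff_superset_sum by blast
  from feas have sum1: "sum z UNIV = 1" and nonneg: "\<And>I. z I \<ge> 0"
    and cases: "\<And>l. l \<in> {1..m} \<Longrightarrow> (\<forall>I. aff (g l) (pt I) * z I \<ge> 0) \<or>
      (\<exists>K. aff (g l) (pt K) * z K < 0 \<and> (\<forall>J. J \<noteq> K \<longrightarrow> aff (g l) (pt J) * z J > 0) \<and>
        (\<Sum>I\<in>UNIV. 1 / (aff (g l) (pt I) * z I)) \<le> 0)"
    unfolding lasserre_feasible_superset_sum_iff by blast+
  \<comment> \<open>The masses \<open>z\<close> form a probability vector, so an average of
    \<open>f\<close> below the optimum needs a point of positive mass below it.\<close>
  have "\<exists>I. z I * aff f (pt I) < z I * aff f (pt Iopt)"
  proof (rule ccontr)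
    assume "\<not> ?thesis"
    then have "(\<Sum>I\<in>UNIV. z I * aff f (pt Iopt)) \<le> (\<Sum>I\<in>UNIV. z I * aff f (pt I))"
      by (intro sum_mono) (auto simp: not_less)
    with less sum1 show False by (simp flip: sum_distrib_right)
  qed
  then obtain I where "z I * aff f (pt I) < z I * aff f (pt Iopt)" ..
  with nonneg[of I] have zI: "z I > 0" and "aff f (pt I) < aff f (pt Iopt)"
    by (auto simp: mult_less_cancel_left)
  with assms(3) have "pt I \<notin> ilp_feasible m g" by (auto simp: is_arg_min_def)
  then obtain l where l: "l \<in> {1..m}" and neg: "aff (g l) (pt I) < 0"
    by (auto simp: ilp_feasible_def pt_in_cube)
  from neg zI have "aff (g l) (pt I) * z I < 0" by (rule mult_neg_pos)
  with cases[OF l] obtain K where "aff (g l) (pt K) * z K < 0"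
    "\<And>J. J \<noteq> K \<Longrightarrow> aff (g l) (pt J) * z J > 0" by (meson not_le)
  \<comment> \<open>All products of this single constraint are nonzero, which forces full
    support.\<close>
  then have "z J \<noteq> 0" for J by (metis less_irrefl mult_zero_right)
  with nonneg have pos: "z J > 0" for J by (simp add: less_le)
  have "\<exists>K. aff (g l) (pt K) * z K < 0 \<and> (\<forall>J. J \<noteq> K \<longrightarrow> aff (g l) (pt J) * z J > 0) \<and>
      (\<Sum>I\<in>UNIV. 1 / (aff (g l) (pt I) * z I)) \<le> 0" if "l \<in> {1..m}" for l
  proof -
    from assms(2) that have "\<not> (\<forall>x\<in>range pt. aff (g l) x \<ge> 0)"
      unfolding cube_eq_range_pt by blast
    then obtain J where "aff (g l) (pt J) < 0"
      by (auto simp: not_le)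
    \<comment> \<open>Full support turns a violation of any constraint on the cube into a negative
      entry, which rules out its nonnegative case.\<close>
    then have "aff (g l) (pt J) * z J < 0" using pos by (rule mult_neg_pos)
    with cases[OF that] show ?thesis by (meson not_le)
  qed
  then obtain K where K: "\<And>l. l \<in> {1..m} \<Longrightarrow> aff (g l) (pt (K l)) * z (K l) < 0 \<and>
      (\<forall>J. J \<noteq> K l \<longrightarrow> aff (g l) (pt J) * z J > 0) \<and>
      (\<Sum>I\<in>UNIV. 1 / (aff (g l) (pt I) * z I)) \<le> 0"
    by metis
  have ex1: "\<exists>!I. aff (g l) (pt I) * z I < 0" if "l \<in> {1..m}" for l
    using K[OF that] by (intro ex1I[of _ "K l"]) (auto dest: less_asym)
  show ?cert
    by (intro exI[of _ z] exI[of _ K] conjI) (use pos sum1 K ex1 less in \<open>simp_all\<close>)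
next
  assume ?cert
  then obtain z K where pos: "\<forall>I. z I > 0" and sum1: "sum z UNIV = 1"
    and K: "\<forall>l\<in>{1..m}. (\<exists>!I. aff (g l) (pt I) * z I < 0) \<and> aff (g l) (pt (K l)) * z (K l) < 0"
      "\<forall>l\<in>{1..m}. \<forall>J. J \<noteq> K l \<longrightarrow> aff (g l) (pt J) * z J > 0"
      "\<forall>l\<in>{1..m}. (\<Sum>I\<in>UNIV. 1 / (aff (g l) (pt I) * z I)) \<le> 0"
    and less: "(\<Sum>I\<in>UNIV. z I * aff f (pt I)) < aff f (pt Iopt)"
    by (elim exE conjE) (rule that)
  have "superset_sum z \<in> lasserre_feasible (CARD('n) - 1) m g"
    unfolding lasserre_feasible_superset_sum_iff
  proof (intro conjI allI ballI)
    show "z I \<ge> 0" for I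
      using pos by (simp add: less_imp_le)
    fix l assume "l \<in> {1..m}"
    with K show "(\<forall>I. aff (g l) (pt I) * z I \<ge> 0) \<or>
      (\<exists>K. aff (g l) (pt K) * z K < 0 \<and> (\<forall>J. J \<noteq> K \<longrightarrow> aff (g l) (pt J) * z J > 0) \<and>
        (\<Sum>I\<in>UNIV. 1 / (aff (g l) (pt I) * z I)) \<le> 0)"
      by (intro disjI2 exI[of _ "K l"]) simp
  qed (rule sum1)
  with less show ?gap unfolding integrality_gap_iff_superset_sum by blast
qed

end
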